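(* Let $X=\begin{pmatrix}w&x\\ y&z\end{pmatrix}\in M_2(\mathbb{N}_0)^\bullet$ be doubly-balanced with $\gcd(wz,xy)=1$. If $X$ is not an atom of $M_2(\mathbb{N}_0)^\bullet$, then $$x\le 2(z-1)(w-1),\quad y\le 2(z-1)(w-1),\quad w\le 2(x-1)(y-1),\quad z\le 2(x-1)(y-1).$$
   Context: $M_2(\mathbb{N}_0)^\bullet$ is the semigroup, under matrix multiplication, of $2\times 2$ matrices with non-negative integer entries and non-zero determinant. Its only units are $I=\begin{pmatrix}1&0\\0&1\end{pmatrix}$ and $J=\begin{pmatrix}0&1\\1&0\end{pmatrix}$. An atom is a non-unit $X\in M_2(\mathbb{N}_0)^\bullet$ such that whenever $X=AB$ with $A,B\in M_2(\mathbb{N}_0)^\bullet$, at least one of $A,B$ is a unit. A row of a $2\times2$ matrix is dominant if both of its entries are greater than or equal to the corresponding entries of the other row; a column is dominant if both of its entries are greater than or equal to the corresponding entries of the other column. A matrix is row-balanced if neither row is dominant, column-balanced if neither column is dominant, and doubly-balanced if it is both row- and column-balanced. The inequalities are between integers (differences such as $w-1$ are taken in $\mathbb{Z}$), and $\gcd(n,0)=n$. *)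

theory Defs
  imports "HOL-Analysis.Analysis" "HOL-Algebra.Group"
begin

text \<open>Entries are taken in the integers rather than in the type of natural numbers, so that
  determinants and the differences in the theorem are genuine integers; the carrier restricts
  to matrices with non-negative entries.\<close>

definition M2_nonneg :: "(int ^ 2 ^ 2) monoid" where
  "M2_nonneg = \<lparr>carrier = {A. (\<forall>i j. 0 \<le> A $ i $ j) \<and> det A \<noteq> 0}, mult = (**), one = mat 1\<rparr>"

definition monoid_atom :: "('a, 'b) monoid_scheme \<Rightarrow> 'a \<Rightarrow> bool" where
  "monoid_atom G a \<longleftrightarrow> a \<in> carrier G \<and> a \<notin> Units G \<and>
     (\<forall>b\<in>carrier G. \<forall>c\<in>carrier G. a = b \<otimes>\<^bsub>G\<^esub> c \<longrightarrow> b \<in> Units G \<or> c \<in> Units G)"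

definition dominant_row :: "int ^ 2 ^ 2 \<Rightarrow> 2 \<Rightarrow> bool" where
  "dominant_row A i \<longleftrightarrow> (\<forall>k. k \<noteq> i \<longrightarrow> (\<forall>j. A $ k $ j \<le> A $ i $ j))"

definition dominant_column :: "int ^ 2 ^ 2 \<Rightarrow> 2 \<Rightarrow> bool" where
  "dominant_column A j \<longleftrightarrow> (\<forall>k. k \<noteq> j \<longrightarrow> (\<forall>i. A $ i $ k \<le> A $ i $ j))"

definition row_balanced :: "int ^ 2 ^ 2 \<Rightarrow> bool" where
  "row_balanced A \<longleftrightarrow> \<not> (\<exists>i. dominant_row A i)"

definition column_balanced :: "int ^ 2 ^ 2 \<Rightarrow> bool" where
  "column_balanced A \<longleftrightarrow> \<not> (\<exists>j. dominant_column A j)"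

definition doubly_balanced :: "int ^ 2 ^ 2 \<Rightarrow> bool" where
  "doubly_balanced A \<longleftrightarrow> row_balanced A \<and> column_balanced A"

lemma monoid_M2_nonneg: "monoid M2_nonneg"
proof (rule monoidI)
  show "\<one>\<^bsub>M2_nonneg\<^esub> \<in> carrier M2_nonneg"
    by (simp add: M2_nonneg_def) (simp add: mat_def)
  show "A \<otimes>\<^bsub>M2_nonneg\<^esub> B \<in> carrier M2_nonneg"
    if "A \<in> carrier M2_nonneg" "B \<in> carrier M2_nonneg" for A B
    using that by (simp add: M2_nonneg_def det_mul) (simp add: matrix_matrix_mult_def sum_nonneg)
qed (simp_all add: M2_nonneg_def matrix_mul_assoc)

lemma Units_M2_nonneg:
  "Units M2_nonneg = {vector [vector [1, 0], vector [0, 1]], vector [vector [0, 1], vector [1, 0]]}"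
proof -
  let ?I = "vector [vector [1, 0], vector [0, 1]] :: int ^ 2 ^ 2"
  let ?J = "vector [vector [0, 1], vector [1, 0]] :: int ^ 2 ^ 2"
  note ext = vec_eq_iff forall_2 vector_2 matrix_matrix_mult_def sum_2 mat_def
  have "A = ?I \<or> A = ?J" if "A \<in> Units M2_nonneg" for A
  proof -
    obtain B where nonneg: "\<forall>i j. 0 \<le> A $ i $ j" "\<forall>i j. 0 \<le> B $ i $ j"
      and AB: "A ** B = mat 1" "B ** A = mat 1"
      using \<open>A \<in> Units M2_nonneg\<close> by (auto simp: Units_def M2_nonneg_def)
    define a b c d where "a = A $ 1 $ 1" "b = A $ 1 $ 2" "c = A $ 2 $ 1" "d = A $ 2 $ 2"
    define p q r s where "p = B $ 1 $ 1" "q = B $ 1 $ 2" "r = B $ 2 $ 1" "s = B $ 2 $ 2"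
    note defs = a_b_c_d_def p_q_r_s_def
    have nn: "0 \<le> a" "0 \<le> b" "0 \<le> c" "0 \<le> d" "0 \<le> p" "0 \<le> q" "0 \<le> r" "0 \<le> s"
      using nonneg by (auto simp: defs)
    have e: "a * p + b * r = 1" "a * q + b * s = 0" "c * p + d * r = 0" "c * q + d * s = 1"
      "p * a + q * c = 1" "p * b + q * d = 0" "r * a + s * c = 0" "r * b + s * d = 1"
      using AB by (auto simp: defs ext)
    have "a * q = 0" "b * s = 0" "c * p = 0" "d * r = 0" "p * b = 0" "q * d = 0" "r * a = 0" "s * c = 0"
      using e nn by (simp_all add: add_nonneg_eq_0_iff)
    note z = this
    have "a = 1 \<and> b = 0 \<and> c = 0 \<and> d = 1 \<or> a = 0 \<and> b = 1 \<and> c = 1 \<and> d = 0"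
    proof (cases "a = 0")
      case True
      then have "b * r = 1" "q * c = 1" using e(1,5) by simp_all
      then show ?thesis
        using True z(4) nn by (simp add: zmult_eq_1_iff)
    next
      case False
      then have "q = 0" "r = 0" using z(1,7) by simp_all
      then have "a * p = 1" "d * s = 1" using e(1,4) by simp_all
      then show ?thesis
        using z(2,3) nn by (simp add: zmult_eq_1_iff)
    qed
    then show ?thesis by (auto simp: defs ext)
  qed
  moreover have "?I ** ?I = mat 1" "?J ** ?J = mat 1"
    by (simp_all add: ext)
  moreover have "?I \<in> carrier M2_nonneg" "?J \<in> carrier M2_nonneg"
    by (simp_all add: M2_nonneg_def det_2 forall_2)
  moreover have "A \<in> Units M2_nonneg" if "A \<in> carrier M2_nonneg" "A ** A = mat 1" for A
    using that by (auto simp: Units_def M2_nonneg_def)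
  ultimately show ?thesis by blast
qed

end

theory Submission
  imports Defs
begin

text \<open>
  For a doubly-balanced matrix, both entries of one of the two diagonals exceed both entries of the
  other. Swapping the columns, which is multiplication by the unit \<open>J\<close>, exchanges the diagonals, so
  let \<open>w\<close> and \<open>z\<close> be the large entries. The bounds on the small entries \<open>x\<close> and \<open>y\<close> then hold by
  size alone (\<open>small_entry_bound\<close>); the factorization is needed for \<open>w\<close> and \<open>z\<close>.

  Let \<open>X = A B\<close> with \<open>A\<close>, \<open>B\<close> non-units. The determinant of \<open>X\<close> is positive, so after replacing
  \<open>A\<close>, \<open>B\<close> by \<open>A J\<close>, \<open>J B\<close> if necessary, both factors have positive determinant and hence positive
  diagonal entries. The key point is that all other entries of the factors are positive too: a zero
  off the diagonal, together with coprimality and the dominance of the diagonal of \<open>X\<close>, makes the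
  factor containing it the identity (\<open>left_factor_identity\<close>). With all entries positive, write
  \<open>w = a e + b g\<close>, \<open>x = a f + b h\<close> and \<open>y = c e + d g\<close>: then \<open>x - 1\<close> is at least \<open>a\<close> and at least
  \<open>b\<close>, while \<open>y - 1\<close> is at least \<open>e\<close> and at least \<open>g\<close>, so each of the two terms of \<open>w\<close> is at most
  \<open>(x - 1) (y - 1)\<close>. The same works for \<open>z\<close>. The units, which are not atoms either, satisfy the
  bounds by inspection.
\<close>

text \<open>The entry \<open>d\<close> divides the second row \<open>(d g, d h)\<close> of the product, so coprimality gives
  \<open>d = 1\<close>. Then \<open>a f + b h < h\<close> forces \<open>b = 0\<close>, and now \<open>a\<close> divides the first row. Transposing the
  product and conjugating it by \<open>J\<close> carry this over to a zero in any other off-diagonal position of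
  either factor.\<close>

lemma left_factor_identity:
  fixes a b d e f g h :: int
  assumes nonneg: "0 \<le> a" "0 \<le> b" "0 \<le> d" "0 \<le> f" "0 \<le> h"
    and coprime: "coprime (a * e + b * g) (a * f + b * h)" "coprime (d * g) (d * h)"
    and less: "a * f + b * h < d * h"
  shows "a = 1 \<and> b = 0 \<and> d = 1"
proof -
  have "is_unit d"
    using coprime(2) by (meson coprime_common_divisor dvd_triv_left)
  then have d: "d = 1" using nonneg by simp
  have b: "b = 0"
  proof (rule ccontr)
    assume "b \<noteq> 0"
    then have "1 * h \<le> b * h" using nonneg by (intro mult_right_mono) auto
    moreover have "0 \<le> a * f" using nonneg by simp
    ultimately show False using less d by simp
  qed
  have "is_unit a"
    using coprime(1) b by (metis add_0_right coprime_common_divisor dvd_triv_left mult_zero_left)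
  then show ?thesis using nonneg d b by simp
qed

lemma sum_of_two_products_le:
  fixes p q r s m n :: int
  assumes "0 \<le> p" "p \<le> m" "0 \<le> q" "q \<le> n" "0 \<le> r" "r \<le> m" "0 \<le> s" "s \<le> n"
  shows "p * q + r * s \<le> 2 * m * n"
proof -
  have "p * q \<le> m * n" "r * s \<le> m * n"
    using assms by (auto intro!: mult_mono)
  then show ?thesis by simp
qed

lemma left_summand_le_sum_minus_one:
  fixes p q r s :: int
  assumes "1 \<le> p" "1 \<le> q" "1 \<le> r" "1 \<le> s"
  shows "p \<le> p * q + r * s - 1"
proof -
  have "p * 1 \<le> p * q" "1 * 1 \<le> r * s"
    using assms mult_mono[of 1 r 1 s] by (auto intro!: mult_left_mono)
  then show ?thesis by simp
qed

lemma large_entries_bound_pos_det: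
  fixes a b c d e f g h w x y z :: int
  assumes nonneg: "0 \<le> a" "0 \<le> b" "0 \<le> c" "0 \<le> d" "0 \<le> e" "0 \<le> f" "0 \<le> g" "0 \<le> h"
    and prod: "w = a * e + b * g" "x = a * f + b * h" "y = c * e + d * g" "z = c * f + d * h"
    and det: "b * c < a * d" "f * g < e * h"
    and A: "(a, b, c, d) \<noteq> (1, 0, 0, 1)" and B: "(e, f, g, h) \<noteq> (1, 0, 0, 1)"
    and coprime: "coprime (w * z) (x * y)"
    and less: "x < w" "y < w" "x < z" "y < z"
  shows "w \<le> 2 * (x - 1) * (y - 1) \<and> z \<le> 2 * (x - 1) * (y - 1)"
proof -
  have cop: "coprime w x" "coprime w y" "coprime z x" "coprime z y"
    using coprime by auto
  have "0 \<le> b * c" "0 \<le> f * g" using nonneg by auto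
  then have "a \<noteq> 0" "d \<noteq> 0" "e \<noteq> 0" "h \<noteq> 0" using det by auto
  moreover have "c \<noteq> 0"
    using left_factor_identity[of a b d f h e g] nonneg cop less A prod
    by (auto simp: coprime_commute)
  moreover have "b \<noteq> 0"
    using left_factor_identity[of d c a g e h f] nonneg cop less A prod
    by (auto simp: coprime_commute add.commute)
  moreover have "f \<noteq> 0"
    using left_factor_identity[of e g h c d a b] nonneg cop less B prod
    by (auto simp: coprime_commute mult.commute)
  moreover have "g \<noteq> 0"
    using left_factor_identity[of h f e b a d c] nonneg cop less B prod
    by (auto simp: coprime_commute mult.commute add.commute)
  ultimately have pos: "1 \<le> a" "1 \<le> b" "1 \<le> c" "1 \<le> d" "1 \<le> e" "1 \<le> f" "1 \<le> g" "1 \<le> h"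
    using nonneg by auto
  have "a \<le> x - 1" "b \<le> x - 1" "f \<le> x - 1" "h \<le> x - 1"
    using left_summand_le_sum_minus_one[of a f b h] left_summand_le_sum_minus_one[of b h a f]
      left_summand_le_sum_minus_one[of f a b h] left_summand_le_sum_minus_one[of h b a f] pos prod
    by (auto simp: mult.commute add.commute)
  moreover have "c \<le> y - 1" "d \<le> y - 1" "e \<le> y - 1" "g \<le> y - 1"
    using left_summand_le_sum_minus_one[of c e d g] left_summand_le_sum_minus_one[of d g c e]
      left_summand_le_sum_minus_one[of e c d g] left_summand_le_sum_minus_one[of g d c e] pos prod
    by (auto simp: mult.commute add.commute)
  ultimately show ?thesis
    using sum_of_two_products_le[of a "x - 1" e "y - 1" b g]
      sum_of_two_products_le[of f "x - 1" c "y - 1" h d] nonneg prod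
    by (simp add: mult.commute)
qed

text \<open>The two factors have determinants of equal sign; if both are negative, the columns of the
  left factor and the rows of the right factor are swapped.\<close>

lemma large_entries_bound:
  fixes a b c d e f g h w x y z :: int
  assumes nonneg: "0 \<le> a" "0 \<le> b" "0 \<le> c" "0 \<le> d" "0 \<le> e" "0 \<le> f" "0 \<le> g" "0 \<le> h"
    and prod: "w = a * e + b * g" "x = a * f + b * h" "y = c * e + d * g" "z = c * f + d * h"
    and A: "(a, b, c, d) \<noteq> (1, 0, 0, 1)" "(a, b, c, d) \<noteq> (0, 1, 1, 0)"
    and B: "(e, f, g, h) \<noteq> (1, 0, 0, 1)" "(e, f, g, h) \<noteq> (0, 1, 1, 0)"
    and coprime: "coprime (w * z) (x * y)"
    and less: "x < w" "y < w" "x < z" "y < z"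
  shows "w \<le> 2 * (x - 1) * (y - 1) \<and> z \<le> 2 * (x - 1) * (y - 1)"
proof -
  have "0 \<le> x" "0 \<le> y" using nonneg prod by auto
  then have "x * y < w * z" using less by (intro mult_strict_mono) auto
  moreover have "w * z - x * y = (a * d - b * c) * (e * h - f * g)"
    unfolding prod by (simp add: algebra_simps)
  ultimately have "0 < (a * d - b * c) * (e * h - f * g)" by simp
  then consider "b * c < a * d" "f * g < e * h" | "a * d < b * c" "e * h < f * g"
    by (auto simp: zero_less_mult_iff)
  then show ?thesis
  proof cases
    case 1
    then show ?thesis
      using large_entries_bound_pos_det[OF nonneg prod _ _ A(1) B(1) coprime less] by simp
  next
    case 2
    then show ?thesis
      using nonneg A(2) B(2) coprime less prod
      by (intro large_entries_bound_pos_det[of b a d c g h e f w x y z])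
        (auto simp: mult.commute)
  qed
qed

lemma small_entry_bound:
  fixes w x z :: int
  assumes "0 \<le> x" "x < w" "x < z"
  shows "x \<le> 2 * (z - 1) * (w - 1)"
proof (cases "x = 0")
  case False
  then have "x * 1 \<le> (z - 1) * (w - 1)" using assms by (intro mult_mono) auto
  moreover have "2 * (z - 1) * (w - 1) = 2 * ((z - 1) * (w - 1))" by (rule mult.assoc)
  ultimately show ?thesis using assms by linarith
qed (use assms in auto)

lemma doubly_balanced_iff:
  fixes w x y z :: int
  shows "doubly_balanced (vector [vector [w, x], vector [y, z]]) \<longleftrightarrow>
    (x < w \<and> y < w \<and> x < z \<and> y < z) \<or> (w < x \<and> w < y \<and> z < x \<and> z < y)"
  by (auto simp: doubly_balanced_def row_balanced_def column_balanced_def dominant_row_def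
      dominant_column_def forall_2 exhaust_2 not_le)

lemma vector_2x2_eq_iff:
  fixes A :: "int ^ 2 ^ 2"
  shows "A = vector [vector [a, b], vector [c, d]] \<longleftrightarrow>
    (A $ 1 $ 1, A $ 1 $ 2, A $ 2 $ 1, A $ 2 $ 2) = (a, b, c, d)"
  by (auto simp: vec_eq_iff forall_2 vector_2)

theorem theorem6p1:
  fixes w x y z :: int and X :: "int ^ 2 ^ 2"
  assumes "X = vector [vector [w, x], vector [y, z]]"
    and "X \<in> carrier M2_nonneg"
    and "doubly_balanced X"
    and "gcd (w * z) (x * y) = 1"
    and "\<not> monoid_atom M2_nonneg X"
  shows "x \<le> 2 * (z - 1) * (w - 1) \<and> y \<le> 2 * (z - 1) * (w - 1) \<and>
    w \<le> 2 * (x - 1) * (y - 1) \<and> z \<le> 2 * (x - 1) * (y - 1)"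
proof (cases "X \<in> Units M2_nonneg")
  case True
  then have "(w, x, y, z) = (1, 0, 0, 1) \<or> (w, x, y, z) = (0, 1, 1, 0)"
    using assms(1) by (auto simp: Units_M2_nonneg vector_2x2_eq_iff vector_2)
  then show ?thesis by auto
next
  case False
  then obtain A B where carrier: "A \<in> carrier M2_nonneg" "B \<in> carrier M2_nonneg"
    and X: "X = A ** B"
    and nonunit: "A \<notin> Units M2_nonneg" "B \<notin> Units M2_nonneg"
    using assms(2,5) by (auto simp: monoid_atom_def M2_nonneg_def)
  define a b c d where "a = A $ 1 $ 1" "b = A $ 1 $ 2" "c = A $ 2 $ 1" "d = A $ 2 $ 2"
  note A_entries = this
  define e f g h where "e = B $ 1 $ 1" "f = B $ 1 $ 2" "g = B $ 2 $ 1" "h = B $ 2 $ 2"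
  note B_entries = this
  have nonneg: "0 \<le> a" "0 \<le> b" "0 \<le> c" "0 \<le> d" "0 \<le> e" "0 \<le> f" "0 \<le> g" "0 \<le> h"
    using carrier by (auto simp: A_entries B_entries M2_nonneg_def)
  have prod: "w = a * e + b * g" "x = a * f + b * h" "y = c * e + d * g" "z = c * f + d * h"
    using X assms(1)
    by (auto simp: A_entries B_entries vec_eq_iff forall_2 vector_2 matrix_matrix_mult_def sum_2)
  have A: "(a, b, c, d) \<noteq> (1, 0, 0, 1)" "(a, b, c, d) \<noteq> (0, 1, 1, 0)"
    using nonunit(1) by (auto simp: Units_M2_nonneg vector_2x2_eq_iff A_entries)
  have B: "(e, f, g, h) \<noteq> (1, 0, 0, 1)" "(e, f, g, h) \<noteq> (0, 1, 1, 0)"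
    using nonunit(2) by (auto simp: Units_M2_nonneg vector_2x2_eq_iff B_entries)
  have coprime: "coprime (w * z) (x * y)"
    using assms(4) by (simp add: coprime_iff_gcd_eq_1)
  have entries: "0 \<le> w" "0 \<le> x" "0 \<le> y" "0 \<le> z"
    using nonneg prod by auto
  consider "x < w" "y < w" "x < z" "y < z" | "w < x" "w < y" "z < x" "z < y"
    using assms(1,3) by (auto simp: doubly_balanced_iff)
  then show ?thesis
  proof cases
    case 1
    then show ?thesis
      using large_entries_bound[OF nonneg prod A B coprime] small_entry_bound entries by auto
  next
    case 2
    \<comment> \<open>The factorization \<open>X J = A (B J)\<close> has the large entries on the main diagonal.\<close>
    have "x \<le> 2 * (w - 1) * (z - 1) \<and> y \<le> 2 * (w - 1) * (z - 1)"
      using 2 nonneg A B coprime prod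
      by (intro large_entries_bound[of a b c d f e h g x w z y])
        (auto simp: coprime_commute)
    moreover have "w \<le> 2 * (x - 1) * (y - 1)" "z \<le> 2 * (x - 1) * (y - 1)"
      using small_entry_bound[of w y x] small_entry_bound[of z y x] 2 entries by auto
    ultimately show ?thesis by (simp add: algebra_simps)
  qed
qed

end
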